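(* Let $L$, $N$, $T$ be positive real numbers. With the quantities $w_k(\mathbf m)$, $\bar w_k(L,N,T)$, $\mathcal W_k(\mathbf m)$, $\bar{\mathcal W}_k(L,N,T)$ defined in the context, the following hold for every $k\in\mathbb N$ (where $\mathbf 0\in\mathbb R^{k+1}$ denotes the zero measurement vector, of the length appropriate to the index): a) $w_k(\mathbf 0) = 2\bar h_k$, where $$\bar h_k = h_o(\underline k),\qquad \underline k = \min\{k,K\},\qquad h_o(\ell) := \frac12 LT\ell + \frac{2N}{T\ell},$$ $$K := \begin{cases} Q & \text{if } Q^2+Q \ge \frac{4N}{LT^2},\\ Q+1 & \text{otherwise,}\end{cases}\qquad Q := \left\lfloor \frac{2}{T}\sqrt{\frac{N}{L}}\right\rfloor ;$$ b) $w_k(\mathbf 0)\ge w_{k+1}(\mathbf 0)$; c) $w_k(\mathbf 0) = \mathcal W_k(\mathbf 0)$; d) $w_k(\mathbf 0) = \bar w_k(L,N,T) = \bar{\mathcal W}_k(L,N,T)$.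
   Context: $\mathbb N$ denotes the positive integers; $\lfloor a\rfloor$ is the greatest integer not greater than $a$. Fix reals $L,N,T>0$ (second-derivative bound, noise bound, sampling period) and $k\in\mathbb N$. Admissible functions. A function $\mathfrak f:\mathbb R_{\ge0}\to\mathbb R$ is considered that is differentiable with derivative $\mathfrak f^{(1)}$ globally Lipschitz continuous with Lipschitz constant $L$, i.e. $|\mathfrak f^{(2)}(t)|\le L$ for almost all $t\ge 0$. A vector $\mathbf m=[m_0,\dots,m_k]^T\in\mathbb R^{k+1}$ is a possible measurement vector for $\mathfrak f$ if $m_j=\mathfrak f(jT)+\eta_j$ with $|\eta_j|\le N$, i.e. $|\mathfrak f(jT)-m_j|\le N$, for $j=0,1,\dots,k$. Let $\mathcal M_k(L,N,T)$ be the set of all $\mathbf m\in\mathbb R^{k+1}$ for which there exists such an admissible $\mathfrak f$ with $\mathbf m$ as possible measurement vector. Best possible bounds. For $\mathbf m\in\mathbb R^{k+1}$ let $\mathcal F_k^1(\mathbf m)$ be the set of all values $\mathfrak f^{(1)}(kT)$, where $\mathfrak f$ ranges over admissible functions for which $\mathbf m$ is a possible measurement vector. For $\mathbf m\in\mathcal M_k(L,N,T)$ put $$\mathcal W_k(\mathbf m):=\sup\mathcal F_k^1(\mathbf m)-\inf\mathcal F_k^1(\mathbf m),\qquad \bar{\mathcal W}_k(L,N,T):=\sup_{\mathbf m\in\mathcal M_k(L,N,T)}\mathcal W_k(\mathbf m).$$ Linear-programming differentiator. For $\mathbf m\in\mathbb R^{k+1}$ let $\mathcal C_k(\mathbf m)\subset\mathbb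 R^{2k+2}$ be the set of all vectors $\mathbf x=[f_0,\dots,f_k,f_0^1,\dots,f_k^1]^T$ satisfying $$|f_j^1-f_{j-1}^1|\le LT\quad (j=1,\dots,k),$$ $$|f_{j-1}-f_j+f_j^1T|\le L\tfrac{T^2}{2}\quad (j=1,\dots,k),$$ $$|f_j-m_j|\le N\quad (j=0,1,\dots,k).$$ Here $f_j$, $f_j^1$ are real variables (the superscript $1$ is an index, not a power). Whenever $\mathcal C_k(\mathbf m)\neq\emptyset$, define $$\overline f_k^1(\mathbf m):=\max\{f_k^1:\mathbf x\in\mathcal C_k(\mathbf m)\},\qquad \underline f_k^1(\mathbf m):=\min\{f_k^1:\mathbf x\in\mathcal C_k(\mathbf m)\}.$$ The differentiator outputs $\hat{\mathfrak f}_k^1=(\overline f_k^1(\mathbf m)+\underline f_k^1(\mathbf m))/2$, and its accuracy is measured by $$w_k(\mathbf m):=\overline f_k^1(\mathbf m)-\underline f_k^1(\mathbf m),\qquad \bar w_k(L,N,T):=\sup_{\mathbf m\in\mathcal M_k(L,N,T)}w_k(\mathbf m).$$ *)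

theory Defs
  imports "HOL-Analysis.Analysis"
begin

text \<open>
  A vector in \<open>\<real>\<^sup>k\<^sup>+\<^sup>1\<close> is a function \<open>nat \<Rightarrow> real\<close> of which only the entries \<open>0, \<dots>, k\<close> are
  ever inspected; likewise a function on the nonnegative reals is a function \<open>real \<Rightarrow> real\<close> of which
  only the restriction to \<open>{0..}\<close> matters (so the derivative at 0 is one-sided).
\<close>

definition admissible :: "real \<Rightarrow> (real \<Rightarrow> real) \<Rightarrow> bool" where
  "admissible L f \<longleftrightarrow>
     (\<exists>f'. (\<forall>t\<ge>0. (f has_real_derivative f' t) (at t within {0..})) \<and> L-lipschitz_on {0..} f')"

definition possible_measurement ::
  "real \<Rightarrow> real \<Rightarrow> nat \<Rightarrow> (real \<Rightarrow> real) \<Rightarrow> (nat \<Rightarrow> real) \<Rightarrow> bool" where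
  "possible_measurement N T k f m \<longleftrightarrow> (\<forall>j\<le>k. \<bar>f (real j * T) - m j\<bar> \<le> N)"

definition measurements :: "real \<Rightarrow> real \<Rightarrow> real \<Rightarrow> nat \<Rightarrow> (nat \<Rightarrow> real) set" where
  "measurements L N T k = {m. \<exists>f. admissible L f \<and> possible_measurement N T k f m}"

definition derivative_values ::
  "real \<Rightarrow> real \<Rightarrow> real \<Rightarrow> nat \<Rightarrow> (nat \<Rightarrow> real) \<Rightarrow> real set" where
  "derivative_values L N T k m =
     {v. \<exists>f. admissible L f \<and> possible_measurement N T k f m \<and>
             (f has_real_derivative v) (at (real k * T) within {0..})}"

text \<open>
  Suprema and infima are taken in \<^typ>\<open>ereal\<close>: on \<^typ>\<open>real\<close> they are unspecified for unbounded
  sets, so that equality with a finite number would not express boundedness.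
\<close>

definition best_width :: "real \<Rightarrow> real \<Rightarrow> real \<Rightarrow> nat \<Rightarrow> (nat \<Rightarrow> real) \<Rightarrow> ereal" where
  "best_width L N T k m =
     (SUP v\<in>derivative_values L N T k m. ereal v) - (INF v\<in>derivative_values L N T k m. ereal v)"

definition best_width_sup :: "real \<Rightarrow> real \<Rightarrow> real \<Rightarrow> nat \<Rightarrow> ereal" where
  "best_width_sup L N T k = (SUP m\<in>measurements L N T k. best_width L N T k m)"

text \<open>
  In a pair \<open>(f, g)\<close>, the component \<open>g j\<close> is the variable \<open>f\<^sub>j\<^sup>1\<close>.
\<close>

definition lp_feasible ::
  "real \<Rightarrow> real \<Rightarrow> real \<Rightarrow> nat \<Rightarrow> (nat \<Rightarrow> real) \<Rightarrow> ((nat \<Rightarrow> real) \<times> (nat \<Rightarrow> real)) set" where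
  "lp_feasible L N T k m =
     {(f, g). (\<forall>j\<in>{1..k}. \<bar>g j - g (j - 1)\<bar> \<le> L * T) \<and>
              (\<forall>j\<in>{1..k}. \<bar>f (j - 1) - f j + g j * T\<bar> \<le> L * (T\<^sup>2 / 2)) \<and>
              (\<forall>j\<in>{0..k}. \<bar>f j - m j\<bar> \<le> N)}"

definition lp_upper :: "real \<Rightarrow> real \<Rightarrow> real \<Rightarrow> nat \<Rightarrow> (nat \<Rightarrow> real) \<Rightarrow> real" where
  "lp_upper L N T k m = (GREATEST v. \<exists>f g. (f, g) \<in> lp_feasible L N T k m \<and> v = g k)"

definition lp_lower :: "real \<Rightarrow> real \<Rightarrow> real \<Rightarrow> nat \<Rightarrow> (nat \<Rightarrow> real) \<Rightarrow> real" where
  "lp_lower L N T k m = (LEAST v. \<exists>f g. (f, g) \<in> lp_feasible L N T k m \<and> v = g k)"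

definition lp_width :: "real \<Rightarrow> real \<Rightarrow> real \<Rightarrow> nat \<Rightarrow> (nat \<Rightarrow> real) \<Rightarrow> real" where
  "lp_width L N T k m = lp_upper L N T k m - lp_lower L N T k m"

definition lp_width_sup :: "real \<Rightarrow> real \<Rightarrow> real \<Rightarrow> nat \<Rightarrow> ereal" where
  "lp_width_sup L N T k = (SUP m\<in>measurements L N T k. ereal (lp_width L N T k m))"

definition Q_idx :: "real \<Rightarrow> real \<Rightarrow> real \<Rightarrow> nat" where
  "Q_idx L N T = nat \<lfloor>2 / T * sqrt (N / L)\<rfloor>"

definition K_idx :: "real \<Rightarrow> real \<Rightarrow> real \<Rightarrow> nat" where
  "K_idx L N T =
     (let Q = Q_idx L N T in
      if (real Q)\<^sup>2 + real Q \<ge> 4 * N / (L * T\<^sup>2) then Q else Q + 1)"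

definition h_o :: "real \<Rightarrow> real \<Rightarrow> real \<Rightarrow> nat \<Rightarrow> real" where
  "h_o L N T l = 1 / 2 * L * T * real l + 2 * N / (T * real l)"

definition h_bar :: "real \<Rightarrow> real \<Rightarrow> real \<Rightarrow> nat \<Rightarrow> real" where
  "h_bar L N T k = h_o L N T (min k (K_idx L N T))"

end

theory Submission
  imports Defs
begin

text \<open>
  Everything follows from one upper bound, valid for all measurement vectors, and one function
  attaining it for zero measurements.

  For the upper bound, each derivative \<open>f'(k T)\<close> of an admissible function compatible with \<open>m\<close> is a feasible
  final slope of the linear program, by Taylor's formula (\<open>derivative_values_subset_lp_values\<close>). For
  each \<open>l\<close> with \<open>1 \<le> l \<le> k\<close>, each feasible final slope differs from the secant slope
  \<open>(m\<^sub>k - m\<^sub>k\<^sub>-\<^sub>l) / (l T)\<close> by at most \<open>h_o l\<close> (\<open>lp_slope_near_quotient\<close>). Hence both the linear program and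
  the set of possible derivatives have width at most \<open>2 h_o l\<close>, for every \<open>m\<close>. Since \<open>h_o\<close>
  is nonincreasing up to \<open>K\<close>, the choice \<open>l = min k K\<close> is made; the bound becomes \<open>2 h_bar\<close>, which
  is therefore nonincreasing in \<open>k\<close>.

  The bound is sharp since for \<open>m = 0\<close> there is an admissible function with derivative \<open>h_bar\<close> at \<open>k T\<close>
  (\<open>h_bar_in_derivative_values\<close>): a parabola leading from \<open>-N\<close> to \<open>N\<close> over the last \<open>l\<close> intervals,
  preceded by an oscillation that equals \<open>-N\<close> at all earlier sampling instants. Together with its
  negative it shows that the width \<open>2 h_bar\<close> is reached, by actual functions and hence by the linear
  program. The worst case over all measurements is therefore attained at \<open>m = 0\<close>.
\<close>

section \<open>Feasible slopes lie near secant slopes\<close>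

text \<open>
  Going \<open>l\<close> steps back from \<open>k\<close>, the one-step constraints accumulate to exactly the estimates
  that a function with second derivative bounded by \<open>L\<close> obeys over the whole span \<open>l T\<close>: in units
  of \<open>L / 2\<close> the errors add up as \<open>(l T)\<^sup>2 + T\<^sup>2 + 2 l T\<^sup>2 = ((l + 1) T)\<^sup>2\<close>, the mixed term being the drift of the slope over \<open>l\<close>
  steps.
\<close>

lemma lp_backward_taylor:
  assumes "(f, g) \<in> lp_feasible L N T k m" and "T > 0" and "l \<le> k"
  shows "\<bar>g k - g (k - l)\<bar> \<le> real l * (L * T)"
    and "\<bar>f (k - l) - f k + real l * T * g k\<bar> \<le> L * (real l * T)\<^sup>2 / 2"
proof -
  have step_g: "\<bar>g j - g (j - 1)\<bar> \<le> L * T"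
    and step_f: "\<bar>f (j - 1) - f j + g j * T\<bar> \<le> L * (T\<^sup>2 / 2)" if "j \<in> {1..k}" for j
    using assms(1) that by (auto simp: lp_feasible_def)
  have "\<bar>g k - g (k - l)\<bar> \<le> real l * (L * T)
    \<and> \<bar>f (k - l) - f k + real l * T * g k\<bar> \<le> L * (real l * T)\<^sup>2 / 2"
    using assms(3)
  proof (induction l)
    case 0
    then show ?case by simp
  next
    case (Suc l)
    define j where "j = k - l"
    have j: "j \<in> {1..k}" "k - Suc l = j - 1" using Suc.prems by (auto simp: j_def)
    have IH: "\<bar>g k - g j\<bar> \<le> real l * (L * T)"
      "\<bar>f j - f k + real l * T * g k\<bar> \<le> L * (real l * T)\<^sup>2 / 2"
      using Suc by (auto simp: j_def)
    have G: "\<bar>g k - g (j - 1)\<bar> \<le> real (Suc l) * (L * T)"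
      using IH(1) step_g[OF j(1)] by (simp add: algebra_simps)
    have "\<bar>T * (g k - g j)\<bar> \<le> T * (real l * (L * T))"
      using IH(1) assms(2) by (simp add: abs_mult)
    moreover have "f (j - 1) - f k + real (Suc l) * T * g k
        = (f (j - 1) - f j + g j * T) + (f j - f k + real l * T * g k) + T * (g k - g j)"
      by (simp add: algebra_simps)
    ultimately have "\<bar>f (j - 1) - f k + real (Suc l) * T * g k\<bar>
        \<le> L * (T\<^sup>2 / 2) + L * (real l * T)\<^sup>2 / 2 + T * (real l * (L * T))"
      using IH(2) step_f[OF j(1)] by linarith
    also have "\<dots> = L * (real (Suc l) * T)\<^sup>2 / 2"
      by (simp add: power2_eq_square field_simps)
    finally show ?case using G j(2) by simp
  qed
  then show "\<bar>g k - g (k - l)\<bar> \<le> real l * (L * T)"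
    and "\<bar>f (k - l) - f k + real l * T * g k\<bar> \<le> L * (real l * T)\<^sup>2 / 2" by auto
qed

text \<open>
  The quotient is the slope of the secant through two measurements. Its distance to the final
  slope has one part from curvature, growing with \<open>l\<close>, and one from noise, decaying with \<open>l\<close>;
  their sum is \<open>h_o\<close>. As the quotient depends on the measurements alone, it is
  a common centre for all feasible slopes, and this bounds the width for arbitrary \<open>m\<close>.
\<close>

lemma lp_slope_near_quotient:
  assumes feas: "(f, g) \<in> lp_feasible L N T k m" and "T > 0" and l: "1 \<le> l" "l \<le> k"
  shows "\<bar>g k - (m k - m (k - l)) / (T * real l)\<bar> \<le> h_o L N T l"
proof -
  have pos: "T * real l > 0" using assms by simp
  have mN: "\<bar>f k - m k\<bar> \<le> N" "\<bar>f (k - l) - m (k - l)\<bar> \<le> N"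
    using feas by (auto simp: lp_feasible_def)
  have "\<bar>f (k - l) - f k + T * real l * g k\<bar> \<le> L * (T * real l)\<^sup>2 / 2"
    using lp_backward_taylor(2)[OF feas \<open>T > 0\<close> l(2)] by (simp only: mult.commute[of T])
  then have "\<bar>T * real l * g k - (m k - m (k - l))\<bar> \<le> L * (T * real l)\<^sup>2 / 2 + 2 * N"
    using mN by linarith
  moreover have "T * real l * g k - (m k - m (k - l))
      = (T * real l) * (g k - (m k - m (k - l)) / (T * real l))"
    by (subst right_diff_distrib) (use pos assms in simp)
  moreover have "L * (T * real l)\<^sup>2 / 2 + 2 * N = (T * real l) * h_o L N T l"
    using assms by (simp add: h_o_def field_simps power2_eq_square)
  ultimately show ?thesis
    using pos assms by (simp add: abs_mult)
qed

section \<open>Samples of admissible functions are feasible\<close>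

text \<open>
  The derivative is not assumed to be differentiable, so instead of a second derivative the
  comparison with a parabola is used: \<open>f\<close> minus its tangent at \<open>b\<close>, plus a parabola of curvature \<open>L\<close>
  with vertex at \<open>b\<close>, is nonincreasing on the left of \<open>b\<close>. The sign \<open>\<sigma>\<close> covers both directions.
\<close>

lemma admissible_backward_taylor:
  assumes der: "\<And>t. t \<ge> 0 \<Longrightarrow> (f has_real_derivative f' t) (at t within {0..})"
    and lip: "L-lipschitz_on {0..} f'" and ab: "0 \<le> a" "a \<le> b"
  shows "\<bar>f a - f b + f' b * (b - a)\<bar> \<le> L * (b - a)\<^sup>2 / 2"
proof (cases "a = b")
  case False
  with ab have "a < b" by simp
  have nonneg: "0 \<le> \<sigma> * (f a - f b + f' b * (b - a)) + L * (b - a)\<^sup>2 / 2"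
    if \<sigma>: "\<bar>\<sigma>\<bar> = 1" for \<sigma> :: real
  proof -
    define \<psi> where "\<psi> t = \<sigma> * (f t - f' b * t) + L * (b - t)\<^sup>2 / 2" for t
    have D: "(\<psi> has_real_derivative (\<sigma> * (f' t - f' b) - L * (b - t))) (at t within {a..b})"
      if "t \<in> {a..b}" for t
      unfolding \<psi>_def using that ab
      by (auto intro!: derivative_eq_intros DERIV_subset[OF der] simp: field_simps)
    obtain x where x: "x \<in> {a<..<b}"
        "\<psi> b - \<psi> a = (\<sigma> * (f' x - f' b) - L * (b - x)) * (b - a)"
      using mvt_simple[OF \<open>a < b\<close>, of \<psi> "\<lambda>t. (*) (\<sigma> * (f' t - f' b) - L * (b - t))"] D
      by (auto simp: has_field_derivative_def)
    have "\<bar>f' x - f' b\<bar> \<le> L * (b - x)"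
      using lipschitz_onD[OF lip, of x b] x(1) ab by (auto simp: dist_real_def)
    then have "\<sigma> * (f' x - f' b) \<le> L * (b - x)"
      using \<sigma> by (metis abs_ge_self abs_mult mult_1 order_trans)
    then have "\<psi> b \<le> \<psi> a"
      using x(2) \<open>a < b\<close> by (smt (verit) mult_nonpos_nonneg)
    then show ?thesis by (simp add: \<psi>_def algebra_simps)
  qed
  show ?thesis using nonneg[of 1, simplified] nonneg[of "-1", simplified] by linarith
qed simp

lemma samples_feasible:
  assumes der: "\<And>t. t \<ge> 0 \<Longrightarrow> (f has_real_derivative f' t) (at t within {0..})"
    and lip: "L-lipschitz_on {0..} f'" and "T > 0" and meas: "possible_measurement N T k f m"
  shows "(\<lambda>j. f (real j * T), \<lambda>j. f' (real j * T)) \<in> lp_feasible L N T k m"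
proof -
  have gap: "real j * T - real (j - 1) * T = T" and nn: "0 \<le> real (j - 1) * T"
    "0 \<le> real j * T" if "j \<in> {1..k}" for j
    using that \<open>T > 0\<close> by (auto simp: of_nat_diff algebra_simps)
  have "\<bar>f' (real j * T) - f' (real (j - 1) * T)\<bar> \<le> L * T" if "j \<in> {1..k}" for j
    using lipschitz_onD[OF lip, of "real j * T" "real (j - 1) * T"] gap[OF that] nn[OF that] \<open>T > 0\<close>
    by (simp add: dist_real_def)
  moreover have "\<bar>f (real (j - 1) * T) - f (real j * T) + f' (real j * T) * T\<bar> \<le> L * (T\<^sup>2 / 2)"
    if "j \<in> {1..k}" for j
    using admissible_backward_taylor[OF der lip, of "real (j - 1) * T" "real j * T"]
      gap[OF that] nn[OF that] \<open>T > 0\<close> by simp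
  ultimately show ?thesis
    using meas by (simp add: lp_feasible_def possible_measurement_def)
qed

definition lp_values :: "real \<Rightarrow> real \<Rightarrow> real \<Rightarrow> nat \<Rightarrow> (nat \<Rightarrow> real) \<Rightarrow> real set" where
  "lp_values L N T k m = {v. \<exists>f g. (f, g) \<in> lp_feasible L N T k m \<and> v = g k}"

text \<open>
  Samples of an admissible function and of its derivative satisfy the linear constraints. Since
  \<open>k T\<close> is an interior point of the half-line, the derivative there is unique, so the value \<open>v\<close> is
  the sample of the Lipschitz derivative.
\<close>

lemma derivative_values_subset_lp_values:
  assumes "T > 0" and "k \<ge> 1"
  shows "derivative_values L N T k m \<subseteq> lp_values L N T k m"
proof
  fix v assume "v \<in> derivative_values L N T k m"
  then obtain f f' where der: "\<And>t. t \<ge> 0 \<Longrightarrow> (f has_real_derivative f' t) (at t within {0..})"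
    and lip: "L-lipschitz_on {0..} f'" and meas: "possible_measurement N T k f m"
    and v: "(f has_real_derivative v) (at (real k * T) within {0..})"
    by (auto simp: derivative_values_def admissible_def)
  have pos: "real k * T > 0" using assms by simp
  then have "at (real k * T) within {0..} = at (real k * T)"
    by (intro at_within_interior) simp
  with v der[of "real k * T"] pos have "v = f' (real k * T)"
    by (auto intro: DERIV_unique)
  with samples_feasible[OF der lip \<open>T > 0\<close> meas] show "v \<in> lp_values L N T k m"
    unfolding lp_values_def by blast
qed

section \<open>The optimal number of intervals\<close>

text \<open>
  The case distinction in the definition of \<open>K\<close> selects the least positive integer with
  \<open>4 N / (L T\<^sup>2) \<le> K (K + 1)\<close>; the bound \<open>K (K - 1) \<le> 4 N / (L T\<^sup>2)\<close> expresses minimality. It is these two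
  inequalities, rather than the formula for \<open>K\<close>, that the optimality of \<open>h_bar\<close> rests on.
\<close>

lemma K_idx_bounds:
  assumes "L > 0" "N > 0" "T > 0"
  defines "K \<equiv> real (K_idx L N T)" and "c \<equiv> 4 * N / (L * T\<^sup>2)"
  shows "K_idx L N T \<ge> 1" and "K * (K - 1) \<le> c" and "c \<le> K * (K + 1)"
proof -
  define Q where "Q = Q_idx L N T"
  define r where "r = 2 / T * sqrt (N / L)"
  have r0: "r > 0" and r2: "r\<^sup>2 = c"
    using assms by (auto simp: r_def c_def power_mult_distrib power_divide)
  have "Q = nat \<lfloor>r\<rfloor>" by (simp only: Q_def Q_idx_def r_def)
  then have "real Q \<le> r" "r < real Q + 1" using r0 by linarith+
  then have Qc: "(real Q)\<^sup>2 \<le> c" "c \<le> (real Q + 1)\<^sup>2"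
    using r0 unfolding r2[symmetric] by (auto intro!: power_mono)
  have c0: "c > 0" using r0 r2 by auto
  have K: "K_idx L N T = (if (real Q)\<^sup>2 + real Q \<ge> c then Q else Q + 1)"
    by (simp add: K_idx_def Q_def c_def Let_def)
  show "K_idx L N T \<ge> 1"
    using K c0 by (cases Q) auto
  show "K * (K - 1) \<le> c"
    using K Qc by (auto simp: K_def power2_eq_square algebra_simps split: if_splits)
  show "c \<le> K * (K + 1)"
    using K Qc by (auto simp: K_def power2_eq_square algebra_simps split: if_splits)
qed

text \<open>
  The step from \<open>n\<close> to \<open>n + 1\<close> changes \<open>h_o\<close> by \<open>L T / 2 - 2 N / (T n (n + 1))\<close>, which is
  nonpositive as long as \<open>n (n + 1) \<le> 4 N / (L T\<^sup>2)\<close>, in particular for \<open>n < K\<close>.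
\<close>

lemma h_o_antimono:
  assumes "L > 0" "N > 0" "T > 0" "1 \<le> i" "i \<le> l" "l \<le> K_idx L N T"
  shows "h_o L N T l \<le> h_o L N T i"
  using assms(5,6)
proof (induction l rule: dec_induct)
  case (step n)
  define K where "K = real (K_idx L N T)"
  have n: "real n \<ge> 1" "real n + 1 \<le> K" using step assms(4) by (auto simp: K_def)
  have "real n * (real n + 1) \<le> (K - 1) * K" using n by (intro mult_mono) auto
  also have "\<dots> \<le> 4 * N / (L * T\<^sup>2)"
    using K_idx_bounds(2)[OF assms(1-3)] by (simp add: K_def mult.commute)
  finally have *: "real n * (real n + 1) * (L * T\<^sup>2) \<le> 4 * N"
    using assms by (simp add: pos_le_divide_eq)
  have "h_o L N T n - h_o L N T (Suc n)
      = (4 * N - real n * (real n + 1) * (L * T\<^sup>2)) / (2 * T * real n * (real n + 1))"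
    using n assms(3) by (simp add: h_o_def divide_simps power2_eq_square) (simp add: algebra_simps)
  also have "\<dots> \<ge> 0" using * n assms(3) by (intro divide_nonneg_nonneg) auto
  finally show ?case using step by simp
qed simp

section \<open>Interpolation with bounded curvature\<close>

text \<open>
  A function whose derivative is the piecewise linear interpolation of \<open>g\<close> has increments given
  by the trapezoidal rule. The function is built by induction, replacing the part to the right of the last
  node by a parabola \<open>P\<close>; this keeps the Lipschitz constant, since the triangle
  inequality through the node splits any pair of points into pieces treated separately.
\<close>

lemma interpolate_samples:
  fixes L T :: real and f g :: "nat \<Rightarrow> real"
  assumes "L \<ge> 0" "T > 0"
    and "\<And>j. j < n \<Longrightarrow> \<bar>g (Suc j) - g j\<bar> \<le> L * T"
    and "\<And>j. j < n \<Longrightarrow> f (Suc j) - f j = T * (g j + g (Suc j)) / 2"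
  shows "\<exists>F F'. (\<forall>t\<ge>0. (F has_real_derivative F' t) (at t within {0..})) \<and> L-lipschitz_on {0..} F'
    \<and> (\<forall>j\<le>n. F (real j * T) = f j \<and> F' (real j * T) = g j)"
  using assms(3,4)
proof (induction n)
  case 0
  have "((\<lambda>t. f 0 + g 0 * t) has_real_derivative g 0) (at t within {0..})" for t
    by (auto intro!: derivative_eq_intros)
  moreover have "L-lipschitz_on {0..} (\<lambda>_. g 0)" using assms(1) by (simp add: lipschitz_on_def)
  ultimately show ?case
    by (intro exI[of _ "\<lambda>t. f 0 + g 0 * t"] exI[of _ "\<lambda>_. g 0"]) auto
next
  case (Suc n)
  then obtain F F' where der: "\<And>t. t \<ge> 0 \<Longrightarrow> (F has_real_derivative F' t) (at t within {0..})"
    and lip: "L-lipschitz_on {0..} F'"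
    and val: "\<And>j. j \<le> n \<Longrightarrow> F (real j * T) = f j \<and> F' (real j * T) = g j"
    by (metis less_Suc_eq)
  define a where "a = real n * T"
  define c where "c = (g (Suc n) - g n) / T"
  define P where "P t = f n + g n * (t - a) + c * (t - a)\<^sup>2 / 2" for t
  define P' where "P' t = g n + c * (t - a)" for t
  define G where "G t = (if t \<in> {0..a} then F t else P t)" for t
  define G' where "G' t = (if t \<in> {0..a} then F' t else P' t)" for t
  have a0: "a \<ge> 0" using assms(2) by (simp add: a_def)
  have Fa: "F a = f n" "F' a = g n" using val[of n] by (auto simp: a_def)
  have Pa: "P a = f n" "P' a = g n" by (auto simp: P_def P'_def)
  have c: "\<bar>c\<bar> \<le> L"
    using Suc.prems(1)[of n] assms(2) by (simp add: c_def abs_divide pos_divide_le_eq)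
  have "(G has_real_derivative G' t) (at t within {0..})" if "t \<ge> 0" for t
  proof -
    have P: "(P has_real_derivative P' s) (at s within S)" for s S
      unfolding P_def P'_def by (auto intro!: derivative_eq_intros)
    have F: "(F has_real_derivative F' s) (at s within {0..a})" if "s \<in> {0..a}" for s
      using that by (intro DERIV_subset[OF der]) auto
    have cl: "{0..a} \<union> {0..a} \<inter> {a..} = {0..a}" "{a<..} \<union> {0..a} \<inter> {a..} = {a..}"
      "insert a {0..a} = {0..a}"
      using a0 by auto
    have "(G has_vector_derivative G' t) (at t within {0..})"
      unfolding G_def G'_def
      \<comment> \<open>The closures of \<open>{0..a}\<close> and \<open>{a<..}\<close> meet only in the node, where both pieces agree.\<close>
      by (rule has_vector_derivative_If_within_closures[where T = "{a<..}"])
        (use that a0 F P Fa Pa in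
          \<open>auto simp: cl simp flip: has_real_derivative_iff_has_vector_derivative\<close>)
    then show ?thesis by (simp add: has_real_derivative_iff_has_vector_derivative)
  qed
  moreover have "L-lipschitz_on {0..} G'"
  proof (rule lipschitz_on_leI[OF _ assms(1)])
    fix x y :: real assume xy: "x \<in> {0..}" "y \<in> {0..}" "x \<le> y"
    have F: "\<bar>F' s - F' t\<bar> \<le> L * (t - s)" if "0 \<le> s" "s \<le> t" for s t
      using lipschitz_onD[OF lip, of s t] that by (simp add: dist_real_def)
    have P: "\<bar>P' s - P' t\<bar> \<le> L * (t - s)" if "s \<le> t" for s t
    proof -
      have "\<bar>P' s - P' t\<bar> = \<bar>c\<bar> * (t - s)"
        using that by (simp add: P'_def flip: right_diff_distrib abs_mult) (simp add: abs_mult)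
      then show ?thesis using c that by (simp add: mult_right_mono)
    qed
    consider "y \<le> a" | "a < x" | "x \<le> a" "a < y" by linarith
    then have "\<bar>G' x - G' y\<bar> \<le> L * (y - x)"
    proof cases
      case 3
      then show ?thesis
        using F[of x a] P[of a y] xy Fa Pa by (simp add: G'_def right_diff_distrib)
    qed (use F P xy a0 in \<open>auto simp: G'_def\<close>)
    then show "dist (G' x) (G' y) \<le> L * dist x y"
      using xy by (simp add: dist_real_def)
  qed
  moreover have "G (real j * T) = f j \<and> G' (real j * T) = g j" if "j \<le> Suc n" for j
  proof (cases "j = Suc n")
    case True
    have "P (a + T) = f n + T * (g n + g (Suc n)) / 2" "P' (a + T) = g (Suc n)"
      using assms(2) by (simp_all add: P_def P'_def c_def power2_eq_square field_simps)
    moreover have "real j * T = a + T" using True by (simp add: a_def algebra_simps)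
    ultimately show ?thesis
      using Suc.prems(2)[of n] assms(2) True by (simp add: G_def G'_def)
  next
    case False
    then have "0 \<le> real j * T" "real j * T \<le> a" using that assms(2) by (simp_all add: a_def)
    then show ?thesis using val[of j] that False by (simp add: G_def G'_def)
  qed
  ultimately show ?case by blast
qed

section \<open>The extremal function for zero measurements\<close>

text \<open>
  On the last \<open>l = min k K\<close> intervals the extremal function is the parabola of curvature \<open>L\<close> that
  passes from \<open>-N\<close> to \<open>N\<close>; its final slope is then forced to be \<open>h_o l\<close>, and the monotonicity of
  \<open>h_o\<close> up to \<open>K\<close> ensures that no sample in between drops below \<open>-N\<close>. If \<open>k > K\<close>, the
  function must be continued to the left from the value \<open>-N\<close> with slope \<open>s = h_o K - L T K\<close>. The
  continuation takes the value \<open>-N\<close> at every sampling instant while the slope alternates between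
  \<open>s\<close> and \<open>-s\<close>; between the samples it may leave \<open>[-N, N]\<close>, which no measurement notices. This costs
  curvature \<open>2 \<bar>s\<bar> / T\<close>, and the two inequalities characterizing \<open>K\<close> are equivalent to \<open>\<bar>s\<bar> \<le> L T / 2\<close>.
\<close>

lemma h_bar_in_derivative_values:
  assumes pos: "L > 0" "N > 0" "T > 0" and k: "k \<ge> 1"
  shows "h_bar L N T k \<in> derivative_values L N T k (\<lambda>_. 0)"
proof -
  define K where "K = K_idx L N T"
  define l where "l = min k K"
  define d where "d = k - l"
  define h where "h = h_o L N T l"
  define s where "s = h - L * T * real l"
  have l: "1 \<le> l" "l \<le> k" "l \<le> K"
    using k K_idx_bounds(1)[OF pos] by (auto simp: l_def K_def)
  have Tlh: "T * real l * h = L * (T * real l)\<^sup>2 / 2 + 2 * N"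
    using l pos by (simp add: h_def h_o_def field_simps power2_eq_square)
  define g where "g j = (if j < d then s * (-1) ^ (d - j) else h - L * T * real (k - j))" for j
  define f where "f j = (if j < d then - N else
    N - h * (T * real (k - j)) + L * (T * real (k - j))\<^sup>2 / 2)" for j
  \<comment> \<open>The two branches agree at \<open>j = d\<close>: the parabola has value \<open>-N\<close> and slope \<open>s\<close> there.\<close>
  have left: "g j = s * (-1) ^ (d - j)" "f j = - N" if "j \<le> d" for j
  proof -
    have "k - d = l" using l(2) by (simp add: d_def)
    then have "g d = s" "f d = - N"
      using Tlh by (simp_all add: g_def f_def s_def mult.commute[of h])
    then show "g j = s * (-1) ^ (d - j)" "f j = - N"
      using that by (cases "j = d"; simp add: g_def f_def)+
  qed
  have right: "g j = h - L * T * real (k - j)"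
    "f j = N - h * (T * real (k - j)) + L * (T * real (k - j))\<^sup>2 / 2" if "d \<le> j" for j
    using that by (auto simp: g_def f_def)
  have s: "\<bar>s\<bar> \<le> L * T / 2" if "d > 0"
  proof -
    have lK: "l = K" using that by (auto simp: d_def l_def)
    have LT: "L * T\<^sup>2 > 0" using pos by simp
    have "real l * (real l - 1) * (L * T\<^sup>2) \<le> 4 * N" "4 * N \<le> real l * (real l + 1) * (L * T\<^sup>2)"
      using K_idx_bounds(2,3)[OF pos] LT unfolding lK K_def
      by (simp_all only: pos_le_divide_eq pos_divide_le_eq)
    moreover have "2 * (T * real l) * s = 4 * N - L * T\<^sup>2 * (real l)\<^sup>2"
      using Tlh by (simp add: s_def right_diff_distrib power2_eq_square mult_ac)
    ultimately have "\<bar>2 * (T * real l) * s\<bar> \<le> 2 * (T * real l) * (L * T / 2)"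
      by (simp add: power2_eq_square abs_le_iff algebra_simps)
    then show ?thesis
      using l(1) pos by (simp add: abs_mult)
  qed
  have "\<bar>g (Suc j) - g j\<bar> \<le> L * T \<and> f (Suc j) - f j = T * (g j + g (Suc j)) / 2" if "j < k" for j
  proof (cases "j < d")
    case True
    then have "g (Suc j) = - g j"
      by (simp add: left flip: Suc_diff_Suc)
    moreover have "\<bar>g j\<bar> = \<bar>s\<bar>" using True by (simp add: left abs_mult power_abs)
    ultimately show ?thesis using True s by (simp add: left)
  next
    case False
    define i where "i = k - Suc j"
    have i: "k - Suc j = i" "k - j = Suc i"
      using that by (simp_all add: i_def Suc_diff_Suc)
    have "g j = h - L * T * (real i + 1)" "g (Suc j) = h - L * T * real i"
      "f j = N - h * (T * (real i + 1)) + L * (T * (real i + 1))\<^sup>2 / 2"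
      "f (Suc j) = N - h * (T * real i) + L * (T * real i)\<^sup>2 / 2"
      using False by (simp_all add: right i add.commute)
    note samples = this
    have "g (Suc j) - g j = L * T"
      unfolding samples by (simp add: algebra_simps)
    moreover have "f (Suc j) - f j = T * (g j + g (Suc j)) / 2"
      unfolding samples by (simp add: power2_eq_square field_simps)
    ultimately show ?thesis using pos by simp
  qed
  then obtain F F' where der: "\<And>t. t \<ge> 0 \<Longrightarrow> (F has_real_derivative F' t) (at t within {0..})"
    and lip: "L-lipschitz_on {0..} F'"
    and val: "\<And>j. j \<le> k \<Longrightarrow> F (real j * T) = f j \<and> F' (real j * T) = g j"
    using interpolate_samples[of L T k g f] pos by auto
  have "\<bar>f j\<bar> \<le> N" if "j \<le> k" for j
  proof (cases "j < d \<or> j = k")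
    case True
    then show ?thesis using pos l by (auto simp: f_def d_def)
  next
    case False
    define i where "i = k - j"
    have i: "1 \<le> i" "i \<le> l" using False that by (auto simp: i_def d_def)
    have Ti: "T * real i > 0" using i pos by simp
    \<comment> \<open>Lower bound: multiplied by \<open>T i\<close>, the inequality \<open>h \<le> h_o i\<close> reads \<open>-N \<le> f j\<close>.\<close>
    have "h \<le> h_o L N T i"
      unfolding h_def using h_o_antimono[OF pos i] l(3) by (simp add: K_def)
    then have "(T * real i) * h \<le> (T * real i) * h_o L N T i"
      by (rule mult_left_mono[OF _ less_imp_le[OF Ti]])
    also have "\<dots> = L * (T * real i)\<^sup>2 / 2 + 2 * N"
      using i pos by (simp add: h_o_def field_simps power2_eq_square)
    finally have lower: "- N \<le> f j"
      using False by (simp add: right i_def[symmetric] mult.commute)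
    \<comment> \<open>Upper bound: the parabola is convex with values \<open>-N\<close> and \<open>N\<close> at its ends; concretely, the slope
      of the chord from \<open>i\<close> intervals back to the end is \<open>h - L T i / 2 \<ge> 0\<close>.\<close>
    have "L * (T * real i) / 2 \<le> L * T * real l / 2"
      using i pos by simp
    also have "\<dots> \<le> h" using pos by (simp add: h_def h_o_def)
    finally have "(T * real i) * (L * (T * real i) / 2) \<le> (T * real i) * h"
      by (rule mult_left_mono[OF _ less_imp_le[OF Ti]])
    then have "f j \<le> N"
      using False by (simp add: right i_def[symmetric] power2_eq_square algebra_simps)
    with lower show ?thesis by simp
  qed
  then have "possible_measurement N T k F (\<lambda>_. 0)"
    using val by (simp add: possible_measurement_def)
  moreover have "g k = h_bar L N T k"
    using right[of k] l by (simp add: d_def h_def h_bar_def l_def K_def)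
  ultimately show ?thesis
    using der[of "real k * T"] val[of k] der lip pos
    by (auto simp: derivative_values_def admissible_def)
qed

lemma uminus_derivative_values:
  assumes "v \<in> derivative_values L N T k m"
  shows "- v \<in> derivative_values L N T k (\<lambda>j. - m j)"
proof -
  obtain f where f: "admissible L f" "possible_measurement N T k f m"
    "(f has_real_derivative v) (at (real k * T) within {0..})"
    using assms by (auto simp: derivative_values_def)
  obtain f' where f': "\<forall>t\<ge>0. (f has_real_derivative f' t) (at t within {0..})"
    "L-lipschitz_on {0..} f'"
    using f(1) by (auto simp: admissible_def)
  have "\<forall>t\<ge>0. ((\<lambda>t. - f t) has_real_derivative - f' t) (at t within {0..})"
    using f'(1) by (simp add: DERIV_minus)
  moreover have "L-lipschitz_on {0..} (\<lambda>t. - f' t)"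
    using f'(2) by (rule lipschitz_on_minus)
  ultimately have "admissible L (\<lambda>t. - f t)"
    unfolding admissible_def by (intro exI[of _ "\<lambda>t. - f' t"] conjI)
  moreover have "possible_measurement N T k (\<lambda>t. - f t) (\<lambda>j. - m j)"
    using f(2) by (auto simp: possible_measurement_def abs_le_iff)
  ultimately show ?thesis
    using DERIV_minus[OF f(3)] by (auto simp: derivative_values_def)
qed

section \<open>Attainment of the linear-programming bounds\<close>

text \<open>
  Closedness refers to the product topology on \<^typ>\<open>nat \<Rightarrow> real\<close>, in which each constraint, involving
  finitely many coordinates, is a closed condition.
\<close>

lemma closed_lp_feasible: "closed (lp_feasible L N T k m)"
proof -
  have coord: "continuous_on UNIV (\<lambda>p :: (nat \<Rightarrow> real) \<times> (nat \<Rightarrow> real). fst p i)"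
    "continuous_on UNIV (\<lambda>p :: (nat \<Rightarrow> real) \<times> (nat \<Rightarrow> real). snd p i)" for i
    by (rule continuous_on_product_then_coordinatewise,
        rule continuous_on_fst continuous_on_snd, rule continuous_on_id)+
  have "lp_feasible L N T k m =
      (\<Inter>j\<in>{1..k}. {p. \<bar>snd p j - snd p (j - 1)\<bar> \<le> L * T})
      \<inter> (\<Inter>j\<in>{1..k}. {p. \<bar>fst p (j - 1) - fst p j + snd p j * T\<bar> \<le> L * (T\<^sup>2 / 2)})
      \<inter> (\<Inter>j\<in>{0..k}. {p. \<bar>fst p j - m j\<bar> \<le> N})"
    by (auto simp: lp_feasible_def)
  then show ?thesis
    by (simp only:) (intro closed_Int closed_INT ballI closed_Collect_le continuous_on_rabs
        continuous_on_diff continuous_on_add continuous_on_mult_right continuous_on_const coord)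
qed

text \<open>
  The feasible set itself is unbounded because the coordinates beyond \<open>k\<close> are free. Setting
  them to \<open>0\<close> does not change the attained slopes, and the remaining coordinates are bounded: \<open>f\<close> by the
  noise bound, \<open>g\<close> by its distance to the secant slope over all \<open>k\<close> intervals. By Tychonoff's theorem
  the slopes form a continuous image of a compact set.
\<close>

lemma compact_lp_values:
  assumes "T > 0" and "k \<ge> 1"
  shows "compact (lp_values L N T k m)"
proof -
  define q where "q = (m k - m 0) / (T * real k)"
  define A where "A j = (if j \<le> k then cball (m j) N else {0})" for j
  define B where "B j = (if j \<le> k then cball q (h_o L N T k + real (k - j) * (L * T)) else {0})" for j
  have box: "compact (PiE UNIV X)" if "\<And>j. compact (X j)" for X :: "nat \<Rightarrow> real set"
    using compactin_PiE[of "\<lambda>_. euclidean" UNIV X] that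
    by (simp add: euclidean_product_topology)
  let ?S = "(PiE UNIV A \<times> PiE UNIV B) \<inter> lp_feasible L N T k m"
  have "compact ?S"
    by (intro compact_Int_closed compact_Times box closed_lp_feasible) (auto simp: A_def B_def)
  moreover have "continuous_on ?S (\<lambda>p. snd p k)"
    by (rule continuous_on_product_then_coordinatewise[OF continuous_on_snd[OF continuous_on_id]])
  ultimately have "compact ((\<lambda>p. snd p k) ` ?S)"
    by (rule compact_continuous_image[rotated])
  moreover have "(\<lambda>p. snd p k) ` ?S = lp_values L N T k m"
  proof
    show "lp_values L N T k m \<subseteq> (\<lambda>p. snd p k) ` ?S"
    proof
      fix v assume "v \<in> lp_values L N T k m"
      then obtain f g where fg: "(f, g) \<in> lp_feasible L N T k m" "v = g k"
        by (auto simp: lp_values_def)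
      define f0 where "f0 j = (if j \<le> k then f j else 0)" for j
      define g0 where "g0 j = (if j \<le> k then g j else 0)" for j
      have "(f0, g0) \<in> lp_feasible L N T k m"
        using fg(1) by (auto simp: lp_feasible_def f0_def g0_def)
      moreover have "f0 \<in> PiE UNIV A"
        using fg(1) by (auto simp: lp_feasible_def A_def f0_def dist_real_def abs_minus_commute)
      moreover have "g j \<in> B j" if "j \<le> k" for j
      proof -
        have "\<bar>g k - q\<bar> \<le> h_o L N T k"
          using lp_slope_near_quotient[OF fg(1) assms(1,2)] by (simp add: q_def)
        moreover have "\<bar>g k - g j\<bar> \<le> real (k - j) * (L * T)"
          using lp_backward_taylor(1)[OF fg(1) assms(1), of "k - j"] that by simp
        ultimately show ?thesis using that by (simp add: B_def dist_real_def)
      qed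
      then have "g0 \<in> PiE UNIV B" by (auto simp: g0_def B_def)
      ultimately have "(f0, g0) \<in> ?S" by auto
      then show "v \<in> (\<lambda>p. snd p k) ` ?S"
        using fg(2) by (intro image_eqI[of _ _ "(f0, g0)"]) (auto simp: g0_def)
    qed
  qed (use lp_values_def in fastforce)
  ultimately show ?thesis by simp
qed

text \<open>
  The operators \<^const>\<open>Greatest\<close> and \<^const>\<open>Least\<close> carry information only if the extrema are
  attained; compactness provides this for every measurement vector.
\<close>

lemma lp_bounds_attained:
  assumes "T > 0" and "k \<ge> 1" and "lp_values L N T k m \<noteq> {}"
  shows "lp_upper L N T k m \<in> lp_values L N T k m"
    and "lp_lower L N T k m \<in> lp_values L N T k m"
    and "\<And>v. v \<in> lp_values L N T k m \<Longrightarrow> lp_lower L N T k m \<le> v \<and> v \<le> lp_upper L N T k m"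
proof -
  let ?V = "lp_values L N T k m"
  have mem: "v \<in> ?V \<longleftrightarrow> (\<exists>f g. (f, g) \<in> lp_feasible L N T k m \<and> v = g k)" for v
    by (simp add: lp_values_def)
  have up: "lp_upper L N T k m = (GREATEST v. v \<in> ?V)"
    and lo: "lp_lower L N T k m = (LEAST v. v \<in> ?V)"
    by (simp_all add: lp_upper_def lp_lower_def mem)
  obtain u where u: "u \<in> ?V" "\<And>v. v \<in> ?V \<Longrightarrow> v \<le> u"
    using compact_attains_sup[OF compact_lp_values[OF assms(1,2)] assms(3)] by blast
  obtain w where w: "w \<in> ?V" "\<And>v. v \<in> ?V \<Longrightarrow> w \<le> v"
    using compact_attains_inf[OF compact_lp_values[OF assms(1,2)] assms(3)] by blast
  have "lp_upper L N T k m = u" unfolding up using u by (intro Greatest_equality)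
  moreover have "lp_lower L N T k m = w" unfolding lo using w by (intro Least_equality)
  ultimately show "lp_upper L N T k m \<in> ?V" "lp_lower L N T k m \<in> ?V"
    "\<And>v. v \<in> ?V \<Longrightarrow> lp_lower L N T k m \<le> v \<and> v \<le> lp_upper L N T k m"
    using u w by auto
qed

section \<open>Worst-case widths\<close>

text \<open>
  The bound of the slope by the secant over \<open>l\<close> intervals, used with the best available \<open>l\<close>.
\<close>

lemma lp_values_near:
  assumes pos: "L > 0" "N > 0" "T > 0" and k: "k \<ge> 1"
  obtains q where "\<And>v. v \<in> lp_values L N T k m \<Longrightarrow> q - h_bar L N T k \<le> v \<and> v \<le> q + h_bar L N T k"
proof
  let ?l = "min k (K_idx L N T)"
  let ?q = "(m k - m (k - ?l)) / (T * real ?l)"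
  fix v assume "v \<in> lp_values L N T k m"
  then obtain f g where "(f, g) \<in> lp_feasible L N T k m" "v = g k"
    by (auto simp: lp_values_def)
  then have "\<bar>v - ?q\<bar> \<le> h_bar L N T k"
    using lp_slope_near_quotient[of f g L N T k m ?l] pos(3) k K_idx_bounds(1)[OF pos]
    by (simp add: h_bar_def)
  then show "?q - h_bar L N T k \<le> v \<and> v \<le> ?q + h_bar L N T k" by linarith
qed

lemma derivative_values_nonempty:
  assumes "T > 0" and "m \<in> measurements L N T k"
  shows "derivative_values L N T k m \<noteq> {}"
proof -
  obtain f f' where f: "\<forall>t\<ge>0. (f has_real_derivative f' t) (at t within {0..})"
    "L-lipschitz_on {0..} f'" "possible_measurement N T k f m"
    using assms(2) by (auto simp: measurements_def admissible_def)
  moreover have "(f has_real_derivative f' (real k * T)) (at (real k * T) within {0..})"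
    using f(1) assms(1) by simp
  ultimately show ?thesis by (auto simp: derivative_values_def admissible_def)
qed

text \<open>
  Both widths are spreads of sets contained in one interval of length \<open>2 h_bar\<close>, whose centre, but
  not length, depends on \<open>m\<close>.
\<close>

lemma widths_le:
  assumes pos: "L > 0" "N > 0" "T > 0" and k: "k \<ge> 1" and m: "m \<in> measurements L N T k"
  shows "lp_width L N T k m \<le> 2 * h_bar L N T k"
    and "best_width L N T k m \<le> ereal (2 * h_bar L N T k)"
proof -
  let ?h = "h_bar L N T k"
  obtain q where q: "\<And>v. v \<in> lp_values L N T k m \<Longrightarrow> q - ?h \<le> v \<and> v \<le> q + ?h"
    using lp_values_near[OF pos k, of m] by blast
  note sub = derivative_values_subset_lp_values[OF pos(3) k, of L N m]
  have "lp_values L N T k m \<noteq> {}"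
    using derivative_values_nonempty[OF pos(3) m] sub by auto
  from q[OF lp_bounds_attained(1)[OF pos(3) k this]] q[OF lp_bounds_attained(2)[OF pos(3) k this]]
  show "lp_width L N T k m \<le> 2 * ?h" by (simp add: lp_width_def)
  have "best_width L N T k m \<le> ereal (q + ?h) - ereal (q - ?h)"
    unfolding best_width_def using q sub
    by (intro ereal_minus_mono SUP_least INF_greatest) auto
  then show "best_width L N T k m \<le> ereal (2 * ?h)" by simp
qed

text \<open>
  For zero measurements the extremal function and its negative are both compatible with the data,
  so the two ends of the interval of length \<open>2 h_bar\<close> are derivatives of actual functions.
\<close>

lemma widths_zero:
  assumes pos: "L > 0" "N > 0" "T > 0" and k: "k \<ge> 1"
  shows "lp_width L N T k (\<lambda>_. 0) = 2 * h_bar L N T k"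
    and "best_width L N T k (\<lambda>_. 0) = ereal (2 * h_bar L N T k)"
    and "(\<lambda>_. 0) \<in> measurements L N T k"
proof -
  let ?h = "h_bar L N T k" and ?D = "derivative_values L N T k (\<lambda>_. 0)"
  have h: "?h \<in> ?D" by (rule h_bar_in_derivative_values[OF assms])
  have mh: "- ?h \<in> ?D" using uminus_derivative_values[OF h] by simp
  show 0: "(\<lambda>_. 0) \<in> measurements L N T k"
    using h by (auto simp: derivative_values_def measurements_def)
  note sub = derivative_values_subset_lp_values[OF pos(3) k, of L N "\<lambda>_. 0"]
  then have "lp_values L N T k (\<lambda>_. 0) \<noteq> {}" using h by auto
  note att = lp_bounds_attained(3)[OF pos(3) k this]
  have "2 * ?h \<le> lp_width L N T k (\<lambda>_. 0)"
    using att[of ?h] att[of "- ?h"] subsetD[OF sub h] subsetD[OF sub mh]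
    unfolding lp_width_def by linarith
  then show "lp_width L N T k (\<lambda>_. 0) = 2 * ?h"
    using widths_le(1)[OF assms 0] by simp
  have "ereal ?h - ereal (- ?h) \<le> best_width L N T k (\<lambda>_. 0)"
    unfolding best_width_def by (intro ereal_minus_mono SUP_upper INF_lower h mh)
  then show "best_width L N T k (\<lambda>_. 0) = ereal (2 * ?h)"
    using widths_le(2)[OF assms 0] by (intro antisym) simp_all
qed

theorem theorem1:
  fixes L N T :: real and k :: nat
  assumes "L > 0" and "N > 0" and "T > 0" and "k \<ge> 1"
  shows "lp_width L N T k (\<lambda>_. 0) = 2 * h_bar L N T k
    \<and> lp_width L N T k (\<lambda>_. 0) \<ge> lp_width L N T (k + 1) (\<lambda>_. 0)
    \<and> ereal (lp_width L N T k (\<lambda>_. 0)) = best_width L N T k (\<lambda>_. 0)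
    \<and> ereal (lp_width L N T k (\<lambda>_. 0)) = lp_width_sup L N T k
    \<and> lp_width_sup L N T k = best_width_sup L N T k"
proof -
  note zero = widths_zero[OF assms]
  have "h_bar L N T (k + 1) \<le> h_bar L N T k"
    unfolding h_bar_def using assms K_idx_bounds(1)[OF assms(1-3)]
    by (intro h_o_antimono) auto
  then have "lp_width L N T (k + 1) (\<lambda>_. 0) \<le> lp_width L N T k (\<lambda>_. 0)"
    using zero(1) widths_zero(1)[OF assms(1-3), of "k + 1"] by simp
  moreover have "lp_width_sup L N T k = ereal (2 * h_bar L N T k)"
    unfolding lp_width_sup_def
  proof (rule antisym)
    show "ereal (2 * h_bar L N T k) \<le> (SUP m\<in>measurements L N T k. ereal (lp_width L N T k m))"
      using SUP_upper[OF zero(3), of "\<lambda>m. ereal (lp_width L N T k m)"] zero(1) by simp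
  qed (use widths_le(1)[OF assms] in \<open>auto intro!: SUP_least\<close>)
  moreover have "best_width_sup L N T k = ereal (2 * h_bar L N T k)"
    unfolding best_width_sup_def
  proof (rule antisym)
    show "ereal (2 * h_bar L N T k) \<le> (SUP m\<in>measurements L N T k. best_width L N T k m)"
      using SUP_upper[OF zero(3), of "best_width L N T k"] zero(2) by simp
  qed (use widths_le(2)[OF assms] in \<open>auto intro!: SUP_least\<close>)
  ultimately show ?thesis using zero by simp
qed

end
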